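(* Let $A\in\mathbb{R}^{m\times n}$, $b\in\mathbb{R}^m$ satisfy the genericity condition $\widetilde\sigma_n>\sigma_{n+1}$, let $x$ be the unique TLS solution, $r=b-Ax$, and let $L\in\mathbb{R}^{k\times n}$, $k\le n$. Then (with $Lx\ne0$ for the first formula) $$\kappa_\infty^{\mathrm{rel}}=\frac{\left\|\left|LQ_1QQ_1\left[-x^\top\otimes\left(A^\top+\frac{2xr^\top}{1+x^\top x}\right)+I_n\otimes r^\top\right]\right|\mathrm{vec}(|A|)+\left|LQ_1QQ_1\left(A^\top+\frac{2xr^\top}{1+x^\top x}\right)\right||b|\right\|_\infty}{\|Lx\|_\infty},$$ $$\kappa_c=\left\|D_{Lx}^\dagger\left|LQ_1QQ_1\left[-x^\top\otimes\left(A^\top+\frac{2xr^\top}{1+x^\top x}\right)+I_n\otimes r^\top\right]\right|\mathrm{vec}(|A|)+D_{Lx}^\dagger\left|LQ_1QQ_1\left(A^\top+\frac{2xr^\top}{1+x^\top x}\right)\right||b|\right\|_\infty,$$ where $Q_1=I_n+xx^\top$ and $Q=V_{11}D^{-1}V_{11}^\top$.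
   Context: Let $m>n$. The total least squares (TLS) problem for $A\in\mathbb{R}^{m\times n}$, $b\in\mathbb{R}^m$ is to minimize $\|[A,b]-[\widehat A,\widehat b]\|_F$ over $[\widehat A,\widehat b]\in\mathbb{R}^{m\times(n+1)}$ with $\widehat b$ in the range of $\widehat A$; any $x$ with $\widehat A x=\widehat b$ for a minimizer is a TLS solution. Let $\widetilde\sigma_n$ be the smallest singular value of $A$ and let $[A,b]=U\Sigma V^\top$ be an SVD with $U\in\mathbb{R}^{m\times m}$, $V\in\mathbb{R}^{(n+1)\times(n+1)}$ orthogonal and singular values $\sigma_1\ge\dots\ge\sigma_{n+1}\ge0$. Under the genericity condition $\widetilde\sigma_n>\sigma_{n+1}$ the TLS solution $x$ is unique and $\begin{bmatrix}x\\-1\end{bmatrix}=-\frac1{v_{n+1,n+1}}v_{n+1}$, where $v_{n+1}$ is the last column of $V$ and $v_{n+1,n+1}$ its last component. $V_{11}$ is the leading $n\times n$ submatrix of $V$ and $D=\mathrm{Diag}(\sigma_1^2-\sigma_{n+1}^2,\dots,\sigma_n^2-\sigma_{n+1}^2)$. The mixed and componentwise condition numbers of $\Psi(A,b)=Lx$ are $$\kappa_\infty^{\mathrm{rel}}=\frac{\| |L\mathcal N|\mathrm{vec}(|A|)+|L\mathcal H||b| \|_\infty}{\|Lx\|_\infty},\qquad \kappa_c=\|D_{Lx}^\dagger(|L\mathcal N|\mathrm{vec}(|A|)+|L\mathcal H||b|)\|_\infty,$$ where $P=A^\top A-\sigma_{n+1}^2I_n$, $\mathcal N=P^{-1}\left[-x^\top\otimes\left(A^\top+\frac{2xr^\top}{1+x^\top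 x}\right)+I_n\otimes r^\top\right]$, $\mathcal H=P^{-1}\left[A^\top+\frac{2xr^\top}{1+x^\top x}\right]$. $|\cdot|$ is the entrywise absolute value, $\otimes$ the Kronecker product $[a_{ij}B]$, $\mathrm{vec}$ stacks columns, $D_{Lx}$ is the diagonal matrix with diagonal $Lx$, and $\dagger$ is the Moore–Penrose inverse. *)

theory Defs
  imports
    Complex_Main
    "Jordan_Normal_Form.Char_Poly"
    "Jordan_Normal_Form.Gauss_Jordan_Elimination"
begin

text \<open>
  Matrices and vectors have the dimension-carrying types of Jordan_Normal_Form, with indices
  starting at 0; in particular the singular values \<open>\<sigma>\<^sub>1, \<dots>, \<sigma>\<^sub>n\<^sub>+\<^sub>1\<close> of an \<open>m \<times> (n + 1)\<close> matrix are
  \<open>\<sigma> 0, \<dots>, \<sigma> n\<close>.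
\<close>

definition col_matrix :: "real vec \<Rightarrow> real mat" where
  "col_matrix v = mat_of_cols (dim_vec v) [v]"

definition row_matrix :: "real vec \<Rightarrow> real mat" where
  "row_matrix v = mat_of_rows (dim_vec v) [v]"

definition append_col :: "real mat \<Rightarrow> real vec \<Rightarrow> real mat" where
  "append_col A b = mat_of_cols (dim_row A) (cols A @ [b])"

definition kronecker :: "real mat \<Rightarrow> real mat \<Rightarrow> real mat" (infixl \<open>\<otimes>\<^sub>K\<close> 70) where
  "A \<otimes>\<^sub>K B = mat (dim_row A * dim_row B) (dim_col A * dim_col B)
     (\<lambda>(i, j). A $$ (i div dim_row B, j div dim_col B) * B $$ (i mod dim_row B, j mod dim_col B))"

definition stack_cols :: "real mat \<Rightarrow> real vec" where
  "stack_cols A = vec (dim_row A * dim_col A) (\<lambda>l. A $$ (l mod dim_row A, l div dim_row A))"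

abbreviation abs_mat :: "real mat \<Rightarrow> real mat" where
  "abs_mat \<equiv> map_mat abs"

abbreviation abs_vec :: "real vec \<Rightarrow> real vec" where
  "abs_vec \<equiv> map_vec abs"

definition diag_of_vec :: "real vec \<Rightarrow> real mat" where
  "diag_of_vec v = mat_diag (dim_vec v) (\<lambda>i. v $ i)"

text \<open>Meaningful for invertible square matrices only.\<close>

definition minv :: "real mat \<Rightarrow> real mat" where
  "minv A = the (mat_inverse A)"

definition is_moore_penrose :: "real mat \<Rightarrow> real mat \<Rightarrow> bool" where
  "is_moore_penrose A X \<longleftrightarrow>
     X \<in> carrier_mat (dim_col A) (dim_row A) \<and>
     A * X * A = A \<and> X * A * X = X \<and>
     transpose_mat (A * X) = A * X \<and> transpose_mat (X * A) = X * A"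

definition moore_penrose :: "real mat \<Rightarrow> real mat" where
  "moore_penrose A = (THE X. is_moore_penrose A X)"

definition frobenius_norm :: "real mat \<Rightarrow> real" where
  "frobenius_norm A = sqrt (\<Sum>i<dim_row A. \<Sum>j<dim_col A. (A $$ (i, j))\<^sup>2)"

text \<open>For vectors of positive dimension.\<close>

definition max_norm :: "real vec \<Rightarrow> real" where
  "max_norm v = Max ((\<lambda>i. \<bar>v $ i\<bar>) ` {..<dim_vec v})"

text \<open>
  The predicate \<open>orthogonal_mat\<close> of Jordan_Normal_Form asks only for nonzero, pairwise
  orthogonal columns, so orthogonality in the usual sense is spelled out here.
\<close>

definition is_orthogonal :: "nat \<Rightarrow> real mat \<Rightarrow> bool" where
  "is_orthogonal n Q \<longleftrightarrow>
     Q \<in> carrier_mat n n \<and> transpose_mat Q * Q = 1\<^sub>m n \<and> Q * transpose_mat Q = 1\<^sub>m n"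

definition is_svd :: "real mat \<Rightarrow> real mat \<Rightarrow> (nat \<Rightarrow> real) \<Rightarrow> real mat \<Rightarrow> bool" where
  "is_svd A U \<sigma> V \<longleftrightarrow>
     is_orthogonal (dim_row A) U \<and> is_orthogonal (dim_col A) V \<and>
     (\<forall>i < min (dim_row A) (dim_col A). 0 \<le> \<sigma> i) \<and>
     (\<forall>i j. i \<le> j \<longrightarrow> j < min (dim_row A) (dim_col A) \<longrightarrow> \<sigma> j \<le> \<sigma> i) \<and>
     A = U * mat (dim_row A) (dim_col A) (\<lambda>(i, j). if i = j then \<sigma> i else 0) * transpose_mat V"

text \<open>
  The singular values of a matrix with at least as many rows as columns are the square roots
  of the eigenvalues of \<open>A\<^sup>T A\<close>. (For a wide matrix this would add spurious zeros.)
\<close>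

definition smallest_singular_value :: "real mat \<Rightarrow> real" where
  "smallest_singular_value A =
     Min {s. 0 \<le> s \<and> eigenvalue (transpose_mat A * A) (s\<^sup>2)}"

definition tls_feasible :: "real mat \<Rightarrow> real mat \<times> real vec \<Rightarrow> bool" where
  "tls_feasible A = (\<lambda>(A', b').
     A' \<in> carrier_mat (dim_row A) (dim_col A) \<and>
     b' \<in> (\<lambda>y. A' *\<^sub>v y) ` carrier_vec (dim_col A))"

definition tls_minimizer :: "real mat \<Rightarrow> real vec \<Rightarrow> real mat \<times> real vec \<Rightarrow> bool" where
  "tls_minimizer A b =
     is_arg_min (\<lambda>(A', b'). frobenius_norm (append_col A b - append_col A' b')) (tls_feasible A)"

definition tls_solution :: "real mat \<Rightarrow> real vec \<Rightarrow> real vec \<Rightarrow> bool" where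
  "tls_solution A b x \<longleftrightarrow>
     x \<in> carrier_vec (dim_col A) \<and> (\<exists>A' b'. tls_minimizer A b (A', b') \<and> A' *\<^sub>v x = b')"

definition tls_generic :: "real mat \<Rightarrow> real vec \<Rightarrow> bool" where
  "tls_generic A b \<longleftrightarrow>
     smallest_singular_value (append_col A b) < smallest_singular_value A"

text \<open>Under \<open>tls_generic\<close> the solution exists and is unique.\<close>

definition tls_sol :: "real mat \<Rightarrow> real vec \<Rightarrow> real vec" where
  "tls_sol A b = (THE x. tls_solution A b x)"

definition tls_P :: "real mat \<Rightarrow> real vec \<Rightarrow> real mat" where
  "tls_P A b = transpose_mat A * A
     - (smallest_singular_value (append_col A b))\<^sup>2 \<cdot>\<^sub>m 1\<^sub>m (dim_col A)"

text \<open>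
  The condition numbers are defined by their closed forms in terms of the matrices
  \<open>\<N>\<close> (\<open>tls_N\<close>) and \<open>\<H>\<close> (\<open>tls_H\<close>), not as limits of perturbation quotients.
\<close>

definition tls_N :: "real mat \<Rightarrow> real vec \<Rightarrow> real mat" where
  "tls_N A b = (let x = tls_sol A b; r = b - A *\<^sub>v x in
     minv (tls_P A b) *
       ((- row_matrix x) \<otimes>\<^sub>K
          (transpose_mat A + (2 / (1 + x \<bullet> x)) \<cdot>\<^sub>m (col_matrix x * row_matrix r))
        + 1\<^sub>m (dim_col A) \<otimes>\<^sub>K row_matrix r))"

definition tls_H :: "real mat \<Rightarrow> real vec \<Rightarrow> real mat" where
  "tls_H A b = (let x = tls_sol A b; r = b - A *\<^sub>v x in
     minv (tls_P A b) *
       (transpose_mat A + (2 / (1 + x \<bullet> x)) \<cdot>\<^sub>m (col_matrix x * row_matrix r)))"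

definition tls_psi :: "real mat \<Rightarrow> real mat \<Rightarrow> real vec \<Rightarrow> real vec" where
  "tls_psi L A b = L *\<^sub>v tls_sol A b"

definition mixed_cond :: "real mat \<Rightarrow> real mat \<Rightarrow> real vec \<Rightarrow> real" where
  "mixed_cond L A b =
     max_norm (abs_mat (L * tls_N A b) *\<^sub>v stack_cols (abs_mat A)
               + abs_mat (L * tls_H A b) *\<^sub>v abs_vec b)
     / max_norm (tls_psi L A b)"

definition componentwise_cond :: "real mat \<Rightarrow> real mat \<Rightarrow> real vec \<Rightarrow> real" where
  "componentwise_cond L A b =
     max_norm (moore_penrose (diag_of_vec (tls_psi L A b)) *\<^sub>v
       (abs_mat (L * tls_N A b) *\<^sub>v stack_cols (abs_mat A)
        + abs_mat (L * tls_H A b) *\<^sub>v abs_vec b))"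

end

theory Submission
  imports Defs "HOL-Analysis.Convex"
begin

text \<open>
  Both condition numbers are built from \<open>\<N>\<close> and \<open>\<H>\<close>, which have the common left factor
  \<open>P\<^sup>-\<^sup>1\<close>, where \<open>P = A\<^sup>T A - \<sigma>\<^sub>n\<^sub>+\<^sub>1\<^sup>2 I\<close>. So the theorem is the identity \<open>P\<^sup>-\<^sup>1 = Q\<^sub>1 Q Q\<^sub>1\<close>
  together with associativity of the matrix product. With indices from 0, the smallest singular
  value is \<open>\<sigma> n\<close> and its right singular vector is the column \<open>v = col V n\<close>.

  The matrix \<open>A\<^sup>T A\<close> is the leading \<open>n \<times> n\<close> block of \<open>C\<^sup>T C = V diag(\<sigma>\<^sup>2) V\<^sup>T\<close>, where \<open>C = [A, b]\<close>.
  Subtracting \<open>(\<sigma> n)\<^sup>2 V V\<^sup>T\<close> annihilates the contribution of \<open>v\<close>, and what is left in the block is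
  \<open>P = V\<^sub>1\<^sub>1 D V\<^sub>1\<^sub>1\<^sup>T\<close> (lemma \<open>tls_P_factorization\<close>). The block \<open>V\<^sub>1\<^sub>1\<close> is not orthogonal, but the
  orthogonality relations between the columns of \<open>V\<close>, combined with \<open>x\<^sub>i = - v\<^sub>i / v\<^sub>n\<close>, say that
  \<open>V\<^sub>1\<^sub>1\<^sup>T x\<close> is the rest of the last row of \<open>V\<close>. Hence \<open>V\<^sub>1\<^sub>1\<^sup>T (I + x x\<^sup>T) V\<^sub>1\<^sub>1\<close> restores the missing row
  in the orthogonality relations and equals \<open>I\<close> (lemma \<open>leading_block_congruence\<close>). This makes
  \<open>V\<^sub>1\<^sub>1\<^sup>T Q\<^sub>1\<close> the inverse of \<open>V\<^sub>1\<^sub>1\<close>, and inverting the factorization of \<open>P\<close> gives the identity.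

  What remains is to derive the formula for \<open>x\<close> from the definition of a total least squares
  solution as a minimizer. The genericity condition is used through one consequence: an
  eigenvector of \<open>C\<^sup>T C\<close> for \<open>(\<sigma> n)\<^sup>2\<close> whose last component vanishes would restrict to an
  eigenvector of \<open>A\<^sup>T A\<close> for the same eigenvalue, so that \<open>A\<close> would have a singular value
  \<open>\<le> \<sigma> n\<close>. It follows that \<open>v\<^sub>n \<noteq> 0\<close> and that \<open>\<sigma> n\<close> is a simple singular value, without any
  interlacing theorem. Since \<open>v\<^sub>n \<noteq> 0\<close>, the matrix \<open>C - C v v\<^sup>T\<close> is feasible, and its distance from \<open>C\<close> is
  \<open>\<sigma> n\<close>. So if \<open>x\<close> comes from a minimizer \<open>C'\<close> and \<open>z = (x, -1)\<close>, then \<open>C' z = 0\<close> yields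
  \<open>|C z| = |(C - C') z| \<le> \<sigma> n |z|\<close>, which by simplicity forces \<open>z\<close> to be a multiple of \<open>v\<close>. In
  particular \<open>x\<close> is the only solution, which identifies it with \<open>tls_sol A b\<close>.
\<close>

(* The inner product of Euclidean spaces has the same infix symbol as the scalar product of
   vectors; only the latter is meant below. *)
unbundle no inner_syntax

section \<open>Inverses, pseudoinverses and the Frobenius norm\<close>

lemma minv_eqI:
  assumes "A \<in> carrier_mat n n" and "B \<in> carrier_mat n n" and "A * B = 1\<^sub>m n"
  shows "minv A = B"
proof -
  have BA: "B * A = 1\<^sub>m n"
    using mat_mult_left_right_inverse assms by blast
  have "A \<in> Units (ring_mat TYPE(real) n ())"
    using assms BA by (auto simp: Units_def ring_mat_def)
  then obtain X where X: "mat_inverse A = Some X"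
    using mat_inverse(1)[OF assms(1), where b = "()"] by (cases "mat_inverse A") auto
  then have AX: "A * X = 1\<^sub>m n" and Xc: "X \<in> carrier_mat n n"
    using mat_inverse(2)[OF assms(1)] by auto
  have "X = B * A * X"
    using BA Xc by simp
  also have "\<dots> = B"
    using AX assms(1,2) Xc by (simp add: assoc_mult_mat[of _ n n _ n _ n])
  finally show ?thesis
    using X by (simp add: minv_def)
qed

text \<open>
  The four Penrose equations determine \<open>X\<close>: they make \<open>A X\<close> and \<open>A Y\<close> self-adjoint projections
  onto the same range, hence equal, and likewise \<open>X A = Y A\<close>; then \<open>Y = Y A Y = X A X = X\<close>.
\<close>

lemma moore_penrose_eqI:
  assumes X: "is_moore_penrose A X"
  shows "moore_penrose A = X"
  unfolding moore_penrose_def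
proof (rule the_equality)
  show "is_moore_penrose A X" by fact
next
  fix Y assume Y: "is_moore_penrose A Y"
  define p q where "p = dim_row A" and "q = dim_col A"
  have A: "A \<in> carrier_mat p q" unfolding p_def q_def by (rule carrier_matI) simp_all
  have X': "X \<in> carrier_mat q p" "A * X * A = A" "X * A * X = X"
      "transpose_mat (A * X) = A * X" "transpose_mat (X * A) = X * A"
    and Y': "Y \<in> carrier_mat q p" "A * Y * A = A" "Y * A * Y = Y"
      "transpose_mat (A * Y) = A * Y" "transpose_mat (Y * A) = Y * A"
    using X Y unfolding is_moore_penrose_def p_def q_def by - (elim conjE, assumption)+
  have Ac: "A * X \<in> carrier_mat p p" "A * Y \<in> carrier_mat p p"
    "X * A \<in> carrier_mat q q" "Y * A \<in> carrier_mat q q"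
    using A X'(1) Y'(1) by auto
  have AXAY: "A * X * (A * Y) = A * Y"
    by (simp only: X'(2) flip: assoc_mult_mat[OF Ac(1) A Y'(1)])
  have AYAX: "A * Y * (A * X) = A * X"
    by (simp only: Y'(2) flip: assoc_mult_mat[OF Ac(2) A X'(1)])
  have YAXA: "Y * A * (X * A) = Y * A"
    by (simp only: assoc_mult_mat[OF Y'(1) A Ac(3)] X'(2) flip: assoc_mult_mat[OF A X'(1) A])
  have XAYA: "X * A * (Y * A) = X * A"
    by (simp only: assoc_mult_mat[OF X'(1) A Ac(4)] Y'(2) flip: assoc_mult_mat[OF A Y'(1) A])
  have AY: "A * Y = A * X"
    using transpose_mult[OF Ac(1,2)] by (simp only: AXAY AYAX X'(4) Y'(4))
  have YA: "Y * A = X * A"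
    using transpose_mult[OF Ac(4,3)] by (simp only: YAXA XAYA X'(5) Y'(5))
  have "Y = X * A * Y" by (simp only: Y'(3) flip: YA)
  also have "\<dots> = X * A * X"
    by (simp only: assoc_mult_mat[OF X'(1) A Y'(1)] assoc_mult_mat[OF X'(1) A X'(1)] AY)
  finally show "Y = X" by (simp only: X'(3))
qed

text \<open>
  The convention \<open>inverse 0 = 0\<close> makes this formula right at zero entries as well.
\<close>

lemma moore_penrose_diag_of_vec:
  "moore_penrose (diag_of_vec v) = mat_diag (dim_vec v) (\<lambda>i. inverse (v $ i))"
proof -
  have eqs: "a * inverse a * a = a" "inverse a * a * inverse a = inverse a" for a :: real
    by (cases "a = 0"; simp)+
  have sym: "transpose_mat (mat_diag n f) = mat_diag n f" for n and f :: "nat \<Rightarrow> real"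
    by (intro eq_matI) (auto simp: mat_diag_def)
  show ?thesis
    by (rule moore_penrose_eqI)
      (simp add: is_moore_penrose_def diag_of_vec_def sym eqs, simp add: mat_diag_def)
qed

lemma norm_sq_mult_le_frobenius:
  assumes E: "E \<in> carrier_mat p q" and z: "z \<in> carrier_vec q"
  shows "(E *\<^sub>v z) \<bullet> (E *\<^sub>v z) \<le> (frobenius_norm E)\<^sup>2 * (z \<bullet> z)"
proof -
  have "(E *\<^sub>v z) \<bullet> (E *\<^sub>v z) = (\<Sum>i<p. (\<Sum>j<q. E $$ (i, j) * z $ j)\<^sup>2)"
    using E z by (auto simp: scalar_prod_def power2_eq_square lessThan_atLeast0 intro!: sum.cong)
  also have "\<dots> \<le> (\<Sum>i<p. (\<Sum>j<q. (E $$ (i, j))\<^sup>2) * (\<Sum>j<q. (z $ j)\<^sup>2))"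
    by (intro sum_mono Cauchy_Schwarz_ineq_sum)
  also have "\<dots> = (\<Sum>i<p. \<Sum>j<q. (E $$ (i, j))\<^sup>2) * (\<Sum>j<q. (z $ j)\<^sup>2)"
    by (simp add: sum_distrib_right)
  also have "\<dots> = (frobenius_norm E)\<^sup>2 * (z \<bullet> z)"
    using E z by (simp add: frobenius_norm_def sum_nonneg scalar_prod_def power2_eq_square
        lessThan_atLeast0)
  finally show ?thesis .
qed

text \<open>
  This computes the size of the perturbation \<open>C v v\<^sup>T\<close>, which replaces \<open>C\<close> by a matrix with
  \<open>v\<close> in its kernel when \<open>v\<close> is a unit vector.
\<close>

lemma frobenius_norm_sq_rank_one:
  assumes C: "C \<in> carrier_mat p q" and v: "v \<in> carrier_vec q"
  shows "(frobenius_norm (col_matrix (C *\<^sub>v v) * row_matrix v))\<^sup>2 = ((C *\<^sub>v v) \<bullet> (C *\<^sub>v v)) * (v \<bullet> v)"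
proof -
  have "(frobenius_norm (col_matrix (C *\<^sub>v v) * row_matrix v))\<^sup>2
      = (\<Sum>i<p. \<Sum>j<q. ((C *\<^sub>v v) $ i * v $ j)\<^sup>2)"
    using C v by (simp add: frobenius_norm_def sum_nonneg col_matrix_def row_matrix_def
        scalar_prod_def mat_of_cols_index mat_of_rows_index del: index_mult_mat_vec)
  also have "\<dots> = (\<Sum>i<p. ((C *\<^sub>v v) $ i)\<^sup>2) * (\<Sum>j<q. (v $ j)\<^sup>2)"
    by (simp add: power_mult_distrib sum_product)
  also have "\<dots> = ((C *\<^sub>v v) \<bullet> (C *\<^sub>v v)) * (v \<bullet> v)"
    using C v by (simp add: scalar_prod_def power2_eq_square lessThan_atLeast0)
  finally show ?thesis .
qed

text \<open>
  The hypothesis \<open>T S W = I\<close> makes \<open>T S\<close> the inverse of \<open>W\<close>, so that the inverse of \<open>W D T\<close>, read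
  off factor by factor, is \<open>S W D\<^sup>-\<^sup>1 T S\<close>. It is applied with \<open>T\<close> the transpose of \<open>W\<close>.
\<close>

lemma congruence_inverse:
  fixes W :: "real mat"
  assumes c: "W \<in> carrier_mat n n" "D \<in> carrier_mat n n" "E \<in> carrier_mat n n"
      "T \<in> carrier_mat n n" "S \<in> carrier_mat n n"
    and TSW: "T * S * W = 1\<^sub>m n" and DE: "D * E = 1\<^sub>m n"
  shows "(W * D * T) * (S * (W * E * T) * S) = 1\<^sub>m n"
proof -
  note mc = mult_carrier_mat[of _ n n _ n]
  have "(W * D * T) * (S * (W * E * T) * S) = W * (D * ((T * S * W) * (E * (T * S))))"
    using c by (simp add: assoc_mult_mat[of _ n n _ n _ n] mc)
  also have "\<dots> = W * ((D * E) * (T * S))"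
    unfolding TSW using c by (simp add: assoc_mult_mat[of _ n n _ n _ n] mc)
  also have "\<dots> = W * (T * S)"
    unfolding DE using c by simp
  also have "\<dots> = 1\<^sub>m n"
    using c TSW by (intro mat_mult_left_right_inverse[of "T * S" n W]) auto
  finally show ?thesis .
qed

section \<open>The Gram matrix in singular coordinates\<close>

lemma svd_factors:
  assumes "is_svd C U \<sigma> V" and "C \<in> carrier_mat p q"
  shows "U \<in> carrier_mat p p" and "transpose_mat U * U = 1\<^sub>m p"
    and "V \<in> carrier_mat q q" and "transpose_mat V * V = 1\<^sub>m q" and "V * transpose_mat V = 1\<^sub>m q"
    and "C = U * mat p q (\<lambda>(i, j). if i = j then \<sigma> i else 0) * transpose_mat V"
  using assms(1) unfolding is_svd_def is_orthogonal_def carrier_matD[OF assms(2)]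
  by - (elim conjE, assumption)+

lemma gram_svd:
  assumes svd: "is_svd C U \<sigma> V" and C: "C \<in> carrier_mat p q" and "q \<le> p"
  shows "transpose_mat C * C = V * mat_diag q (\<lambda>i. (\<sigma> i)\<^sup>2) * transpose_mat V"
proof -
  define S where "S = mat p q (\<lambda>(i, j). if i = j then \<sigma> i else 0)"
  have S: "S \<in> carrier_mat p q" by (simp add: S_def)
  note U = svd_factors(1,2)[OF svd C] and V = svd_factors(3)[OF svd C]
    and dec = svd_factors(6)[OF svd C, folded S_def]
  have VT: "transpose_mat V \<in> carrier_mat q q" and UT: "transpose_mat U \<in> carrier_mat p p"
    and ST: "transpose_mat S \<in> carrier_mat q p"
    using U V S by auto
  have US: "U * S \<in> carrier_mat p q" using U S by auto
  have SS: "transpose_mat S * S = mat_diag q (\<lambda>i. (\<sigma> i)\<^sup>2)"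
  proof (rule eq_matI)
    fix i j assume "i < dim_row (mat_diag q (\<lambda>i. (\<sigma> i)\<^sup>2))" "j < dim_col (mat_diag q (\<lambda>i. (\<sigma> i)\<^sup>2))"
    then have ij: "i < q" "j < q" by (auto simp: mat_diag_def)
    have "(transpose_mat S * S) $$ (i, j)
        = (\<Sum>k<p. (if k = i then \<sigma> k else 0) * (if k = j then \<sigma> k else 0))"
      using ij S \<open>q \<le> p\<close>
      by (auto simp: scalar_prod_def lessThan_atLeast0 S_def intro!: sum.cong)
    also have "\<dots> = (\<Sum>k<p. if k = i then (if i = j then (\<sigma> i)\<^sup>2 else 0) else 0)"
      by (intro sum.cong) (auto simp: power2_eq_square)
    also have "\<dots> = mat_diag q (\<lambda>i. (\<sigma> i)\<^sup>2) $$ (i, j)"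
      using ij \<open>q \<le> p\<close> by (simp add: mat_diag_def)
    finally show "(transpose_mat S * S) $$ (i, j) = mat_diag q (\<lambda>i. (\<sigma> i)\<^sup>2) $$ (i, j)" .
  qed (use S in \<open>simp_all add: mat_diag_def\<close>)
  have CT: "transpose_mat C = V * (transpose_mat S * transpose_mat U)"
    unfolding dec transpose_mult[OF US VT] transpose_mult[OF U(1) S] by simp
  have USV: "U * S * transpose_mat V \<in> carrier_mat p q" and SU: "transpose_mat S * transpose_mat U \<in> carrier_mat q p"
    using US VT ST UT by auto
  have "transpose_mat S * transpose_mat U * (U * S) = transpose_mat S * (transpose_mat U * U * S)"
    by (simp only: assoc_mult_mat[OF ST UT US] assoc_mult_mat[OF UT U(1) S])
  then have inner: "transpose_mat S * transpose_mat U * (U * S) = mat_diag q (\<lambda>i. (\<sigma> i)\<^sup>2)"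
    using S by (simp only: U(2) SS left_mult_one_mat)
  have "transpose_mat C * C
      = V * (transpose_mat S * transpose_mat U) * (U * S * transpose_mat V)"
    by (simp only: CT, simp only: dec)
  also have "\<dots> = V * (transpose_mat S * transpose_mat U * (U * S) * transpose_mat V)"
    by (simp only: assoc_mult_mat[OF V SU USV] assoc_mult_mat[OF SU US VT])
  also have "\<dots> = V * mat_diag q (\<lambda>i. (\<sigma> i)\<^sup>2) * transpose_mat V"
    by (simp only: inner assoc_mult_mat[OF V mat_diag_dim VT])
  finally show ?thesis .
qed

lemma sq_norm_gram:
  assumes C: "(C :: real mat) \<in> carrier_mat p q" and z: "z \<in> carrier_vec q"
  shows "(C *\<^sub>v z) \<bullet> (C *\<^sub>v z) = z \<bullet> ((transpose_mat C * C) *\<^sub>v z)"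
  using transpose_vec_mult_scalar[of "transpose_mat C" q p "C *\<^sub>v z" z] C z
  by (simp add: assoc_mult_mat_vec[of _ q p _ q])

lemma mat_diag_mult_vec:
  assumes "z \<in> carrier_vec q"
  shows "mat_diag q f *\<^sub>v z = vec q (\<lambda>i. f i * (z $ i :: real))"
proof (rule eq_vecI)
  fix i assume "i < dim_vec (vec q (\<lambda>i. f i * z $ i))"
  then have i: "i < q" by simp
  have "(mat_diag q f *\<^sub>v z) $ i = (\<Sum>k = 0..<q. (if i = k then f k else 0) * z $ k)"
    using i assms by (simp add: mat_diag_def scalar_prod_def)
  also have "\<dots> = (\<Sum>k = 0..<q. if k = i then f i * z $ i else 0)"
    by (intro sum.cong) auto
  finally show "(mat_diag q f *\<^sub>v z) $ i = vec q (\<lambda>i. f i * z $ i) $ i"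
    using i by simp
qed (simp add: mat_diag_def)

text \<open>
  In the orthonormal coordinates \<open>V\<^sup>T z\<close> the matrix \<open>C\<^sup>T C\<close> acts diagonally. Quadratic forms
  and eigenvectors of \<open>C\<^sup>T C\<close> are read off in these coordinates.
\<close>

lemma gram_in_singular_coordinates:
  assumes svd: "is_svd C U \<sigma> V" and C: "C \<in> carrier_mat p q" and "q \<le> p"
    and z: "z \<in> carrier_vec q" 
  shows "transpose_mat V *\<^sub>v ((transpose_mat C * C) *\<^sub>v z)
    = vec q (\<lambda>i. (\<sigma> i)\<^sup>2 * (transpose_mat V *\<^sub>v z) $ i)"
proof -
  note V = svd_factors(3,4)[OF svd C]
  define D where "D = mat_diag q (\<lambda>i. (\<sigma> i)\<^sup>2)"
  have D: "D \<in> carrier_mat q q" by (simp add: D_def)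
  define y where "y = transpose_mat V *\<^sub>v z"
  have y: "y \<in> carrier_vec q" using V(1) z unfolding y_def by (intro mult_mat_vec_carrier[of _ q q]) simp_all
  have Dy: "D *\<^sub>v y = vec q (\<lambda>i. (\<sigma> i)\<^sup>2 * y $ i)"
    using y by (simp add: D_def mat_diag_mult_vec)
  have VT: "transpose_mat V \<in> carrier_mat q q" and VD: "V * D \<in> carrier_mat q q"
    and Dyc: "D *\<^sub>v y \<in> carrier_vec q"
    using V(1) D y by auto
  have "(transpose_mat C * C) *\<^sub>v z = V *\<^sub>v (D *\<^sub>v y)"
    unfolding gram_svd[OF svd C \<open>q \<le> p\<close>] D_def[symmetric]
      assoc_mult_mat_vec[OF VD VT z] y_def[symmetric] assoc_mult_mat_vec[OF V(1) D y] ..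
  then have "transpose_mat V *\<^sub>v ((transpose_mat C * C) *\<^sub>v z) = D *\<^sub>v y"
    by (simp only: V(2) one_mult_mat_vec[OF Dyc] flip: assoc_mult_mat_vec[OF VT V(1) Dyc])
  from this Dy show ?thesis
    unfolding y_def by (rule trans)
qed

lemma svd_values:
  assumes "is_svd C U \<sigma> V" and "C \<in> carrier_mat p q" and "q \<le> p"
  shows "i < q \<Longrightarrow> 0 \<le> \<sigma> i" and "i \<le> j \<Longrightarrow> j < q \<Longrightarrow> \<sigma> j \<le> \<sigma> i"
proof -
  have "min p q = q" using assms(3) by simp
  then show "i < q \<Longrightarrow> 0 \<le> \<sigma> i" and "i \<le> j \<Longrightarrow> j < q \<Longrightarrow> \<sigma> j \<le> \<sigma> i"
    using assms(1) unfolding is_svd_def carrier_matD[OF assms(2)] by metis+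
qed

lemma svd_rows_orthonormal:
  assumes svd: "is_svd C U \<sigma> V" and C: "C \<in> carrier_mat p q" and "i < q" and "j < q"
  shows "(\<Sum>l<q. V $$ (i, l) * V $$ (j, l)) = (if i = j then 1 else 0)"
proof -
  have "(V * transpose_mat V) $$ (i, j) = (\<Sum>l<q. V $$ (i, l) * V $$ (j, l))"
    using svd_factors(3)[OF svd C] assms(3,4) by (simp add: scalar_prod_def lessThan_atLeast0)
  then show ?thesis
    unfolding svd_factors(5)[OF svd C] using assms(3,4) by simp
qed

lemma svd_cols_orthonormal:
  assumes svd: "is_svd C U \<sigma> V" and C: "C \<in> carrier_mat p q" and "i < q" and "j < q"
  shows "(\<Sum>l<q. V $$ (l, i) * V $$ (l, j)) = (if i = j then 1 else 0)"
proof -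
  have "(transpose_mat V * V) $$ (i, j) = (\<Sum>l<q. V $$ (l, i) * V $$ (l, j))"
    using svd_factors(3)[OF svd C] assms(3,4) by (simp add: scalar_prod_def lessThan_atLeast0)
  then show ?thesis
    unfolding svd_factors(4)[OF svd C] using assms(3,4) by simp
qed

lemma gram_svd_index:
  assumes svd: "is_svd C U \<sigma> V" and C: "C \<in> carrier_mat p q" and "q \<le> p"
    and "i < q" and "j < q"
  shows "(transpose_mat C * C) $$ (i, j) = (\<Sum>l<q. (\<sigma> l)\<^sup>2 * (V $$ (i, l) * V $$ (j, l)))"
  unfolding gram_svd[OF svd C assms(3)] mat_diag_mult_right[OF svd_factors(3)[OF svd C]]
  using svd_factors(3)[OF svd C] assms(4,5)
  by (simp add: scalar_prod_def lessThan_atLeast0 algebra_simps)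

lemma right_singular_expansion:
  assumes svd: "is_svd C U \<sigma> V" and C: "C \<in> carrier_mat p q"
    and z: "z \<in> carrier_vec q"
  shows "z = V *\<^sub>v (transpose_mat V *\<^sub>v z)"
proof -
  note V = svd_factors(3)[OF svd C]
  have VT: "transpose_mat V \<in> carrier_mat q q" using V by simp
  show ?thesis
    by (simp only: svd_factors(5)[OF svd C] one_mult_mat_vec[OF z] flip: assoc_mult_mat_vec[OF V VT z])
qed

lemma svd_inner_product:
  assumes svd: "is_svd C U \<sigma> V" and C: "C \<in> carrier_mat p q"
    and w: "w \<in> carrier_vec q" and z: "z \<in> carrier_vec q"
  shows "(transpose_mat V *\<^sub>v w) \<bullet> (transpose_mat V *\<^sub>v z) = w \<bullet> z"
proof -
  note V = svd_factors(3)[OF svd C]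
  have VT: "transpose_mat V \<in> carrier_mat q q" using V by simp
  have "(transpose_mat V *\<^sub>v w) \<bullet> (transpose_mat V *\<^sub>v z) = w \<bullet> (V *\<^sub>v (transpose_mat V *\<^sub>v z))"
    by (rule transpose_vec_mult_scalar[OF V _ w]) (rule mult_mat_vec_carrier[OF VT z])
  also have "V *\<^sub>v (transpose_mat V *\<^sub>v z) = z"
    by (rule right_singular_expansion[OF svd C z, symmetric])
  finally show ?thesis .
qed

lemma gram_right_singular_vector:
  assumes svd: "is_svd C U \<sigma> V" and C: "C \<in> carrier_mat p q" and qp: "q \<le> p" and i: "i < q"
  shows "(transpose_mat C * C) *\<^sub>v col V i = (\<sigma> i)\<^sup>2 \<cdot>\<^sub>v col V i"
proof (rule eq_vecI)
  note V = svd_factors(3)[OF svd C]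
  show "dim_vec ((transpose_mat C * C) *\<^sub>v col V i) = dim_vec ((\<sigma> i)\<^sup>2 \<cdot>\<^sub>v col V i)"
    using C V by simp
  fix a assume "a < dim_vec ((\<sigma> i)\<^sup>2 \<cdot>\<^sub>v col V i)"
  then have a: "a < q" using V by simp
  have "(M *\<^sub>v col V i) $ a = (\<Sum>j<q. M $$ (a, j) * V $$ (j, i))" if "M \<in> carrier_mat q q" for M
    using that a i V by (simp add: scalar_prod_def lessThan_atLeast0)
  moreover have "transpose_mat C * C \<in> carrier_mat q q" using C by simp
  ultimately have "((transpose_mat C * C) *\<^sub>v col V i) $ a
      = (\<Sum>j<q. (transpose_mat C * C) $$ (a, j) * V $$ (j, i))" by blast
  also have "\<dots> = (\<Sum>j<q. \<Sum>l<q. (\<sigma> l)\<^sup>2 * V $$ (a, l) * (V $$ (j, l) * V $$ (j, i)))"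
    using a by (simp add: gram_svd_index[OF svd C qp] sum_distrib_right mult.assoc)
  also have "\<dots> = (\<Sum>l<q. (\<sigma> l)\<^sup>2 * V $$ (a, l) * (\<Sum>j<q. V $$ (j, l) * V $$ (j, i)))"
    by (subst sum.swap) (simp add: sum_distrib_left)
  also have "\<dots> = (\<Sum>l<q. if l = i then (\<sigma> i)\<^sup>2 * V $$ (a, i) else 0)"
    using i by (intro sum.cong) (auto simp: svd_cols_orthonormal[OF svd C])
  also have "\<dots> = ((\<sigma> i)\<^sup>2 \<cdot>\<^sub>v col V i) $ a"
    using i a V by simp
  finally show "((transpose_mat C * C) *\<^sub>v col V i) $ a = ((\<sigma> i)\<^sup>2 \<cdot>\<^sub>v col V i) $ a" .
qed

lemma right_singular_vector_norm:
  assumes svd: "is_svd C U \<sigma> V" and C: "C \<in> carrier_mat p q" and i: "i < q"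
  shows "col V i \<bullet> col V i = 1"
  using svd_cols_orthonormal[OF svd C i i] svd_factors(3)[OF svd C] i
  by (simp add: scalar_prod_def lessThan_atLeast0)

text \<open>
  Links the singular values defined through eigenvalues of the Gram matrix to the diagonal of a
  given decomposition: a nonzero coordinate of an eigenvector singles out an index \<open>i\<close> with
  \<open>(\<sigma> i)\<^sup>2 = s\<^sup>2\<close>, and the columns of \<open>V\<close> provide the eigenvectors for the converse.
\<close>

lemma singular_values_svd:
  assumes svd: "is_svd C U \<sigma> V" and C: "C \<in> carrier_mat p q" and qp: "q \<le> p"
  shows "{s. 0 \<le> s \<and> eigenvalue (transpose_mat C * C) (s\<^sup>2)} = \<sigma> ` {..<q}"
proof (intro equalityI subsetI)
  fix s assume "s \<in> \<sigma> ` {..<q}"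
  then obtain i where i: "i < q" "s = \<sigma> i" by auto
  have "col V i \<noteq> 0\<^sub>v q"
    using right_singular_vector_norm[OF svd C i(1)] by auto
  then have "eigenvector (transpose_mat C * C) (col V i) (s\<^sup>2)"
    unfolding eigenvector_def i(2) gram_right_singular_vector[OF svd C qp i(1)]
    using C svd_factors(3)[OF svd C] i(1) by auto
  then show "s \<in> {s. 0 \<le> s \<and> eigenvalue (transpose_mat C * C) (s\<^sup>2)}"
    using svd_values(1)[OF svd C qp i(1)] i(2) by (auto simp: eigenvalue_def)
next
  fix s assume "s \<in> {s. 0 \<le> s \<and> eigenvalue (transpose_mat C * C) (s\<^sup>2)}"
  then obtain z where "0 \<le> s" and z: "z \<in> carrier_vec q" "z \<noteq> 0\<^sub>v q"
    and ev: "(transpose_mat C * C) *\<^sub>v z = s\<^sup>2 \<cdot>\<^sub>v z"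
    using C by (auto simp: eigenvalue_def eigenvector_def)
  define y where "y = transpose_mat V *\<^sub>v z"
  note V = svd_factors(3)[OF svd C]
  have VT: "transpose_mat V \<in> carrier_mat q q" using V by simp
  have y: "y \<in> carrier_vec q" unfolding y_def by (rule mult_mat_vec_carrier[OF VT z(1)])
  have "y \<noteq> 0\<^sub>v q"
  proof
    assume "y = 0\<^sub>v q"
    then have "z = V *\<^sub>v 0\<^sub>v q" using right_singular_expansion[OF svd C z(1)] by (simp only: y_def)
    also have "\<dots> = 0\<^sub>v q" using V by auto
    finally show False using z(2) by contradiction
  qed
  then obtain i where i: "i < q" "y $ i \<noteq> 0"
    using y by (metis carrier_vecD eq_vecI index_zero_vec)
  have "vec q (\<lambda>i. (\<sigma> i)\<^sup>2 * y $ i) = s\<^sup>2 \<cdot>\<^sub>v y"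
    using gram_in_singular_coordinates[OF svd C qp z(1)]
    unfolding ev mult_mat_vec[OF VT z(1)] y_def[symmetric] by (rule sym)
  then have "vec q (\<lambda>i. (\<sigma> i)\<^sup>2 * y $ i) $ i = (s\<^sup>2 \<cdot>\<^sub>v y) $ i" by (rule arg_cong)
  then have "(\<sigma> i)\<^sup>2 = s\<^sup>2" using i y by simp
  then have "\<sigma> i = s"
    using svd_values(1)[OF svd C qp i(1)] \<open>0 \<le> s\<close> by (simp add: power2_eq_iff_nonneg)
  then show "s \<in> \<sigma> ` {..<q}" using i by auto
qed

lemma smallest_singular_value_svd:
  assumes svd: "is_svd C U \<sigma> V" and C: "C \<in> carrier_mat p (Suc n)" and np: "Suc n \<le> p"
  shows "smallest_singular_value C = \<sigma> n"
  unfolding smallest_singular_value_def singular_values_svd[OF svd C np]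
  using svd_values(2)[OF svd C np] by (intro Min_eqI) auto

text \<open>
  The minimum in the definition ranges over a finite set, because the squares of its elements are
  roots of the characteristic polynomial; so it is a lower bound.
\<close>

lemma smallest_singular_value_le:
  fixes B :: "real mat"
  assumes B: "B \<in> carrier_mat p q" and ev: "eigenvalue (transpose_mat B * B) (s\<^sup>2)" and s: "0 \<le> s"
  shows "smallest_singular_value B \<le> s"
proof -
  define M where "M = transpose_mat B * B"
  have M: "M \<in> carrier_mat q q" using B by (simp add: M_def)
  have "finite {k. poly (char_poly M) k = 0}"
    using degree_monic_char_poly[OF M] by (intro poly_roots_finite) auto
  moreover have "{s. 0 \<le> s \<and> eigenvalue M (s\<^sup>2)} \<subseteq> sqrt ` {k. poly (char_poly M) k = 0}"
  proof
    fix t assume "t \<in> {s. 0 \<le> s \<and> eigenvalue M (s\<^sup>2)}"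
    then have "t = sqrt (t\<^sup>2)" "poly (char_poly M) (t\<^sup>2) = 0"
      using eigenvalue_root_char_poly[OF M] by auto
    then show "t \<in> sqrt ` {k. poly (char_poly M) k = 0}" by blast
  qed
  ultimately have "finite {s. 0 \<le> s \<and> eigenvalue M (s\<^sup>2)}"
    by (meson finite_imageI finite_subset)
  then show ?thesis
    unfolding smallest_singular_value_def M_def[symmetric]
    using ev s by (intro Min_le) (auto simp: M_def)
qed

section \<open>The generic total least squares problem\<close>

lemma append_col_index:
  assumes "A \<in> carrier_mat m n" and "b \<in> carrier_vec m" and "i < m" and "j < Suc n"
  shows "append_col A b $$ (i, j) = (if j < n then A $$ (i, j) else b $ i)"
proof -
  have "append_col A b $$ (i, j) = (cols A @ [b]) ! j $ i"
    unfolding append_col_def using assms by (subst mat_of_cols_index) simp_all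
  also have "\<dots> = (if j < n then A $$ (i, j) else b $ i)"
  proof (cases "j < n")
    case True
    then show ?thesis using assms by (simp add: nth_append)
  next
    case False
    then have "j = n" using assms(4) by simp
    then show ?thesis using assms(1) by (simp add: nth_append)
  qed
  finally show ?thesis .
qed

lemma append_col_carrier:
  "A \<in> carrier_mat m n \<Longrightarrow> append_col A b \<in> carrier_mat m (Suc n)"
  unfolding append_col_def by (rule carrier_matI) simp_all

text \<open>
  The vector \<open>(y, -1)\<close>: it lies in the kernel of \<open>[A, b]\<close> exactly when \<open>y\<close> solves \<open>A y = b\<close>.
\<close>

definition tls_vec :: "real vec \<Rightarrow> real vec" where
  "tls_vec y = vec (Suc (dim_vec y)) (\<lambda>i. if i < dim_vec y then y $ i else - 1)"

lemma append_col_mult_tls_vec: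
  assumes "A \<in> carrier_mat m n" and "b \<in> carrier_vec m" and "y \<in> carrier_vec n"
  shows "append_col A b *\<^sub>v tls_vec y = A *\<^sub>v y - b"
proof (rule eq_vecI)
  fix i assume "i < dim_vec (A *\<^sub>v y - b)"
  then have i: "i < m" using assms by simp
  have "(append_col A b *\<^sub>v tls_vec y) $ i = (\<Sum>j<Suc n. append_col A b $$ (i, j) * tls_vec y $ j)"
    using i assms append_col_carrier[OF assms(1), of b]
    by (auto simp: scalar_prod_def lessThan_atLeast0 tls_vec_def intro!: sum.cong)
  also have "\<dots> = (\<Sum>j<n. A $$ (i, j) * y $ j) - b $ i"
    using i assms by (simp add: append_col_index tls_vec_def)
  also have "\<dots> = (A *\<^sub>v y - b) $ i"
    using i assms by (simp add: scalar_prod_def lessThan_atLeast0)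
  finally show "(append_col A b *\<^sub>v tls_vec y) $ i = (A *\<^sub>v y - b) $ i" .
qed (use assms append_col_carrier[OF assms(1), of b] in simp)

lemma gram_append_col_index:
  assumes A: "A \<in> carrier_mat m n" and b: "b \<in> carrier_vec m" and "i < n" and "j < n"
  shows "(transpose_mat (append_col A b) * append_col A b) $$ (i, j) = (transpose_mat A * A) $$ (i, j)"
  using assms append_col_carrier[OF A, of b]
  by (simp add: scalar_prod_def append_col_index)

lemma frobenius_norm_nonneg: "0 \<le> frobenius_norm E"
  by (simp add: frobenius_norm_def sum_nonneg)

locale generic_tls =
  fixes m n :: nat and A :: "real mat" and b :: "real vec"
    and U V :: "real mat" and \<sigma> :: "nat \<Rightarrow> real"
  assumes n_less_m: "n < m"
    and A: "A \<in> carrier_mat m n" and b: "b \<in> carrier_vec m"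
    and svd: "is_svd (append_col A b) U \<sigma> V"
    and generic: "tls_generic A b"
begin

abbreviation "C \<equiv> append_col A b"

lemma C: "C \<in> carrier_mat m (Suc n)"
  using A by (rule append_col_carrier)

lemma cols_le_rows: "Suc n \<le> m"
  using n_less_m by simp

lemmas V = svd_factors(3)[OF svd C]

lemma smallest_singular_value_C: "smallest_singular_value C = \<sigma> n"
  by (rule smallest_singular_value_svd[OF svd C cols_le_rows])

lemma last_sigma_nonneg: "0 \<le> \<sigma> n"
  by (rule svd_values(1)[OF svd C cols_le_rows]) simp

text \<open>
  If the last component of \<open>z\<close> is 0, then \<open>C z = A w\<close> for the vector \<open>w\<close> of the other components,
  and the first \<open>n\<close> rows of the eigenvector equation for \<open>z\<close> give \<open>A\<^sup>T A w = (\<sigma> n)\<^sup>2 w\<close>. For \<open>w \<noteq> 0\<close> the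
  number \<open>\<sigma> n\<close> would be a singular value of \<open>A\<close>, which genericity excludes.
\<close>

lemma eigenvector_last_zero_imp_zero:
  assumes z: "z \<in> carrier_vec (Suc n)" and ev: "(transpose_mat C * C) *\<^sub>v z = (\<sigma> n)\<^sup>2 \<cdot>\<^sub>v z"
    and last: "z $ n = 0"
  shows "z = 0\<^sub>v (Suc n)"
proof (rule ccontr)
  assume "z \<noteq> 0\<^sub>v (Suc n)"
  define w where "w = vec n (\<lambda>i. z $ i)"
  have "w \<noteq> 0\<^sub>v n"
  proof
    assume w0: "w = 0\<^sub>v n"
    have "z = 0\<^sub>v (Suc n)"
    proof (rule eq_vecI)
      fix i assume "i < dim_vec (0\<^sub>v (Suc n) :: real vec)"
      then have "i < n \<or> i = n" by auto
      moreover have "z $ i = w $ i" if "i < n" using that by (simp add: w_def)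
      ultimately show "z $ i = 0\<^sub>v (Suc n) $ i" using w0 last by auto
    qed (use z in simp)
    then show False using \<open>z \<noteq> 0\<^sub>v (Suc n)\<close> by contradiction
  qed
  moreover have "(transpose_mat A * A) *\<^sub>v w = (\<sigma> n)\<^sup>2 \<cdot>\<^sub>v w"
  proof (rule eq_vecI)
    fix i assume "i < dim_vec ((\<sigma> n)\<^sup>2 \<cdot>\<^sub>v w)"
    then have i: "i < n" by (simp add: w_def)
    have entry: "(M *\<^sub>v u) $ i = (\<Sum>j<q. M $$ (i, j) * u $ j)"
      if "M \<in> carrier_mat q q" "u \<in> carrier_vec q" "i < q" for q and M :: "real mat" and u
      using that by (simp add: scalar_prod_def lessThan_atLeast0)
    have G: "transpose_mat C * C \<in> carrier_mat (Suc n) (Suc n)" and H: "transpose_mat A * A \<in> carrier_mat n n"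
      using C A by auto
    have "((transpose_mat A * A) *\<^sub>v w) $ i = (\<Sum>j<n. (transpose_mat A * A) $$ (i, j) * w $ j)"
      by (rule entry[OF H _ i]) (simp add: w_def)
    also have "\<dots> = (\<Sum>j<Suc n. (transpose_mat C * C) $$ (i, j) * z $ j)"
      using i last by (simp add: gram_append_col_index[OF A b] w_def del: index_mult_mat)
    also have "\<dots> = ((transpose_mat C * C) *\<^sub>v z) $ i"
      using i by (intro entry[symmetric] G z) simp
    also have "\<dots> = ((\<sigma> n)\<^sup>2 \<cdot>\<^sub>v w) $ i"
      unfolding ev using i z by (simp add: w_def)
    finally show "((transpose_mat A * A) *\<^sub>v w) $ i = ((\<sigma> n)\<^sup>2 \<cdot>\<^sub>v w) $ i" .
  qed (use A in \<open>simp add: w_def\<close>)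
  ultimately have "eigenvalue (transpose_mat A * A) ((\<sigma> n)\<^sup>2)"
    unfolding eigenvalue_def eigenvector_def using A
    by (intro exI[of _ w]) (auto simp: w_def)
  from smallest_singular_value_le[OF A this last_sigma_nonneg]
  show False
    using generic by (simp add: tls_generic_def smallest_singular_value_C)
qed

lemma last_component_nonzero: "V $$ (n, n) \<noteq> 0"
proof
  assume "V $$ (n, n) = 0"
  then have "col V n = 0\<^sub>v (Suc n)"
    using V by (intro eigenvector_last_zero_imp_zero gram_right_singular_vector[OF svd C cols_le_rows] carrier_vecI) auto
  then show False
    using right_singular_vector_norm[OF svd C, of n] by simp
qed

text \<open>
  If \<open>\<sigma> i = \<sigma> n\<close>, then the eigenspace contains the columns \<open>i\<close> and \<open>n\<close> of \<open>V\<close>, and a combination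
  of them with nonzero coefficient at column \<open>i\<close> has last component 0, which is impossible.
\<close>

lemma last_sigma_less:
  assumes i: "i < n"
  shows "\<sigma> n < \<sigma> i"
proof (rule ccontr)
  assume "\<not> \<sigma> n < \<sigma> i"
  then have eq: "\<sigma> i = \<sigma> n"
    using svd_values(2)[OF svd C cols_le_rows, of i n] i by simp
  \<comment> \<open>The coefficients are chosen so that the last components cancel.\<close>
  define a c where "a = V $$ (n, n)" and "c = - V $$ (n, i)"
  define z where "z = a \<cdot>\<^sub>v col V i + c \<cdot>\<^sub>v col V n"
  have cols: "col V i \<in> carrier_vec (Suc n)" "col V n \<in> carrier_vec (Suc n)"
    using V by (auto intro!: carrier_vecI)
  have G: "transpose_mat C * C \<in> carrier_mat (Suc n) (Suc n)" using C by simp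
  have "(transpose_mat C * C) *\<^sub>v z = (\<sigma> n)\<^sup>2 \<cdot>\<^sub>v z"
  proof -
    have "(transpose_mat C * C) *\<^sub>v z
        = a \<cdot>\<^sub>v ((\<sigma> i)\<^sup>2 \<cdot>\<^sub>v col V i) + c \<cdot>\<^sub>v ((\<sigma> n)\<^sup>2 \<cdot>\<^sub>v col V n)"
      unfolding z_def mult_add_distrib_mat_vec[OF G smult_carrier_vec[THEN iffD2, OF cols(1)]
          smult_carrier_vec[THEN iffD2, OF cols(2)]]
        mult_mat_vec[OF G cols(1)] mult_mat_vec[OF G cols(2)]
      by (simp only: gram_right_singular_vector[OF svd C cols_le_rows less_SucI[OF i]]
          gram_right_singular_vector[OF svd C cols_le_rows lessI])
    then show ?thesis
      using cols by (auto simp: z_def eq algebra_simps)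
  qed
  moreover have "z $ n = 0"
    using V i by (simp add: z_def a_def c_def)
  ultimately have "z = 0\<^sub>v (Suc n)"
    using cols by (intro eigenvector_last_zero_imp_zero) (auto simp: z_def)
  then have "col V i \<bullet> z = 0"
    using cols by simp
  moreover have "col V i \<bullet> col V n = 0"
    using svd_cols_orthonormal[OF svd C, of i n] i V by (simp add: scalar_prod_def lessThan_atLeast0)
  then have "col V i \<bullet> z = a"
    using cols right_singular_vector_norm[OF svd C, of i] i
    by (simp add: z_def scalar_prod_add_distrib[of _ "Suc n"])
  ultimately show False
    using last_component_nonzero by (simp add: a_def)
qed

text \<open>
  With \<open>y = V\<^sup>T z\<close> the hypothesis reads \<open>\<Sum>\<^sub>i ((\<sigma> i)\<^sup>2 - (\<sigma> n)\<^sup>2) y\<^sub>i\<^sup>2 \<le> 0\<close>. The coefficients with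
  \<open>i < n\<close> are positive, so only the coordinate of \<open>z\<close> along the last column survives.
\<close>

lemma small_image_imp_parallel:
  assumes z: "z \<in> carrier_vec (Suc n)"
    and le: "(C *\<^sub>v z) \<bullet> (C *\<^sub>v z) \<le> (\<sigma> n)\<^sup>2 * (z \<bullet> z)"
  obtains c where "z = c \<cdot>\<^sub>v col V n"
proof -
  define y where "y = transpose_mat V *\<^sub>v z"
  have VT: "transpose_mat V \<in> carrier_mat (Suc n) (Suc n)" using V by simp
  have y: "y \<in> carrier_vec (Suc n)" unfolding y_def by (rule mult_mat_vec_carrier[OF VT z])
  have Gz: "(transpose_mat C * C) *\<^sub>v z \<in> carrier_vec (Suc n)"
    using C by (intro mult_mat_vec_carrier[OF _ z]) simp
  have "(C *\<^sub>v z) \<bullet> (C *\<^sub>v z) = y \<bullet> vec (Suc n) (\<lambda>i. (\<sigma> i)\<^sup>2 * y $ i)"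
    unfolding sq_norm_gram[OF C z] svd_inner_product[OF svd C z Gz, symmetric]
      gram_in_singular_coordinates[OF svd C cols_le_rows z] y_def ..
  also have "\<dots> = (\<Sum>i<Suc n. (\<sigma> i)\<^sup>2 * (y $ i)\<^sup>2)"
    by (simp add: scalar_prod_def lessThan_atLeast0 power2_eq_square algebra_simps)
  finally have Cz: "(C *\<^sub>v z) \<bullet> (C *\<^sub>v z) = (\<Sum>i<Suc n. (\<sigma> i)\<^sup>2 * (y $ i)\<^sup>2)" .
  have zz: "z \<bullet> z = (\<Sum>i<Suc n. (y $ i)\<^sup>2)"
    unfolding svd_inner_product[OF svd C z z, symmetric] y_def[symmetric]
    using y by (simp add: scalar_prod_def lessThan_atLeast0 power2_eq_square)
  \<comment> \<open>The term \<open>i = n\<close> has coefficient 0 and has been dropped.\<close>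
  have "(\<Sum>i<n. ((\<sigma> i)\<^sup>2 - (\<sigma> n)\<^sup>2) * (y $ i)\<^sup>2) \<le> 0"
    using le unfolding Cz zz by (simp add: sum_distrib_left sum_subtractf algebra_simps)
  moreover have pos: "0 < (\<sigma> i)\<^sup>2 - (\<sigma> n)\<^sup>2" if "i < n" for i
    using last_sigma_less[OF that] last_sigma_nonneg by (simp add: power_strict_mono)
  then have nn: "\<forall>i\<in>{..<n}. 0 \<le> ((\<sigma> i)\<^sup>2 - (\<sigma> n)\<^sup>2) * (y $ i)\<^sup>2"
    by (auto intro!: mult_nonneg_nonneg intro: less_imp_le)
  ultimately have "(\<Sum>i<n. ((\<sigma> i)\<^sup>2 - (\<sigma> n)\<^sup>2) * (y $ i)\<^sup>2) = 0"
    by (intro antisym sum_nonneg) auto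
  then have "\<forall>i\<in>{..<n}. ((\<sigma> i)\<^sup>2 - (\<sigma> n)\<^sup>2) * (y $ i)\<^sup>2 = 0"
    using nn by (subst (asm) sum_nonneg_eq_0_iff) auto
  then have y0: "y $ i = 0" if "i < n" for i
    using pos[OF that] that by (metis lessThan_iff less_irrefl mult_eq_0_iff power_eq_0_iff)
  have "z = y $ n \<cdot>\<^sub>v col V n"
  proof (rule eq_vecI)
    fix i assume "i < dim_vec (y $ n \<cdot>\<^sub>v col V n)"
    then have i: "i < Suc n" using V by simp
    have "z $ i = (V *\<^sub>v y) $ i"
      using right_singular_expansion[OF svd C z] by (simp only: y_def)
    also have "\<dots> = (\<Sum>j<Suc n. V $$ (i, j) * y $ j)"
      using i V y by (simp add: scalar_prod_def lessThan_atLeast0)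
    also have "\<dots> = (y $ n \<cdot>\<^sub>v col V n) $ i"
      using i V by (simp add: y0)
    finally show "z $ i = (y $ n \<cdot>\<^sub>v col V n) $ i" .
  qed (use z V in simp)
  then show thesis by (rule that)
qed

text \<open>
  The witness is \<open>C - C v v\<^sup>T\<close> with \<open>v = col V n\<close>. It annihilates \<open>v\<close>, and scaling \<open>v\<close> to last
  component \<open>-1\<close>, which is possible since \<open>v\<^sub>n \<noteq> 0\<close>, shows that its last column lies in the range of
  the other columns.
\<close>

lemma feasible_at_distance_last_sigma:
  obtains A' b' where "tls_feasible A (A', b')"
    and "(frobenius_norm (C - append_col A' b'))\<^sup>2 = (\<sigma> n)\<^sup>2"
proof -
  define v where "v = col V n"
  have v: "v \<in> carrier_vec (Suc n)" using V unfolding v_def by (intro carrier_vecI) simp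
  have vv: "v \<bullet> v = 1"
    unfolding v_def by (rule right_singular_vector_norm[OF svd C]) simp
  define R where "R = col_matrix (C *\<^sub>v v) * row_matrix v"
  have R: "R \<in> carrier_mat m (Suc n)"
    using C v unfolding R_def col_matrix_def row_matrix_def by (intro carrier_matI) simp_all
  have R_index: "R $$ (i, j) = (C *\<^sub>v v) $ i * v $ j" if "i < m" "j < Suc n" for i j
    using that C v by (simp add: R_def col_matrix_def row_matrix_def scalar_prod_def
        mat_of_cols_index mat_of_rows_index del: index_mult_mat_vec)
  define A' b' where "A' = mat m n (\<lambda>(i, j). (C - R) $$ (i, j))" and "b' = vec m (\<lambda>i. (C - R) $$ (i, n))"
  have A': "A' \<in> carrier_mat m n" and b': "b' \<in> carrier_vec m" by (simp_all add: A'_def b'_def)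
  have app: "append_col A' b' = C - R"
  proof (rule eq_matI)
    fix i j assume "i < dim_row (C - R)" "j < dim_col (C - R)"
    then have ij: "i < m" "j < Suc n" using R by auto
    then show "append_col A' b' $$ (i, j) = (C - R) $$ (i, j)"
      unfolding append_col_index[OF A' b' ij] by (auto simp: A'_def b'_def less_Suc_eq)
  qed (use R append_col_carrier[OF A', of b'] in auto)
  have "C - append_col A' b' = R"
    unfolding app using C R by (intro eq_matI) auto
  then have frob: "(frobenius_norm (C - append_col A' b'))\<^sup>2 = (\<sigma> n)\<^sup>2"
    unfolding R_def
    by (simp add: frobenius_norm_sq_rank_one[OF C v] vv sq_norm_gram[OF C v])
       (simp add: v_def gram_right_singular_vector[OF svd C cols_le_rows] V vv[unfolded v_def])
  define y where "y = vec n (\<lambda>i. - v $ i / v $ n)"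
  have vn: "v $ n \<noteq> 0" using last_component_nonzero V by (simp add: v_def)
  have y: "y \<in> carrier_vec n" by (simp add: y_def)
  have "A' *\<^sub>v y = b'"
  proof (rule eq_vecI)
    fix i assume "i < dim_vec b'"
    then have i: "i < m" by (simp add: b'_def)
    have "(\<Sum>j<Suc n. (C - R) $$ (i, j) * v $ j)
        = (\<Sum>j<Suc n. C $$ (i, j) * v $ j) - (C *\<^sub>v v) $ i * (\<Sum>j<Suc n. v $ j * v $ j)"
      using i R by (simp add: R_index algebra_simps sum_subtractf sum_distrib_left del: sum.lessThan_Suc
          index_mult_mat_vec)
    also have "(\<Sum>j<Suc n. v $ j * v $ j) = 1"
      using vv v by (simp add: scalar_prod_def lessThan_atLeast0)
    also have "(\<Sum>j<Suc n. C $$ (i, j) * v $ j) = (C *\<^sub>v v) $ i"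
      using i C v by (simp add: scalar_prod_def lessThan_atLeast0)
    finally have "(\<Sum>j<n. (C - R) $$ (i, j) * v $ j) = - (C - R) $$ (i, n) * v $ n"
      by simp
    moreover have "(A' *\<^sub>v y) $ i = (\<Sum>j<n. (C - R) $$ (i, j) * v $ j) * (- 1 / v $ n)"
      using i by (simp add: A'_def y_def scalar_prod_def lessThan_atLeast0 sum_negf sum_divide_distrib)
    ultimately show "(A' *\<^sub>v y) $ i = b' $ i"
      using i vn by (simp add: b'_def)
  qed (simp add: A'_def b'_def)
  then have "tls_feasible A (A', b')"
    unfolding tls_feasible_def using A A' y by auto
  then show thesis using frob by (rule that)
qed

text \<open>
  A minimizer is at most as far from \<open>C\<close> as the competitor of the previous lemma. Since it kills
  \<open>z = (x, -1)\<close>, the length of \<open>C z\<close> is at most \<open>\<sigma> n\<close> times that of \<open>z\<close>, so \<open>z\<close> is parallel to the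
  last right singular vector, and its last component fixes the scale.
\<close>

lemma tls_solution_components:
  assumes sol: "tls_solution A b x"
  shows "x \<in> carrier_vec n" and "\<And>i. i < n \<Longrightarrow> x $ i = - V $$ (i, n) / V $$ (n, n)"
proof -
  from sol obtain A1 b1 where x: "x \<in> carrier_vec n" and min: "tls_minimizer A b (A1, b1)"
    and A1x: "A1 *\<^sub>v x = b1"
    using A by (auto simp: tls_solution_def)
  from min have feas: "tls_feasible A (A1, b1)"
    and least: "\<And>A' b'. tls_feasible A (A', b') \<Longrightarrow>
      frobenius_norm (C - append_col A1 b1) \<le> frobenius_norm (C - append_col A' b')"
    by (force simp: tls_minimizer_def is_arg_min_linorder)+
  have A1: "A1 \<in> carrier_mat m n" using feas A by (auto simp: tls_feasible_def)
  have b1: "b1 \<in> carrier_vec m" using A1 x A1x by auto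
  obtain A' b' where "tls_feasible A (A', b')" "(frobenius_norm (C - append_col A' b'))\<^sup>2 = (\<sigma> n)\<^sup>2"
    by (rule feasible_at_distance_last_sigma)
  then have E_le: "(frobenius_norm (C - append_col A1 b1))\<^sup>2 \<le> (\<sigma> n)\<^sup>2"
    using least by (metis frobenius_norm_nonneg power_mono)
  define z where "z = tls_vec x"
  have z: "z \<in> carrier_vec (Suc n)" using x by (simp add: z_def tls_vec_def)
  have C1: "append_col A1 b1 \<in> carrier_mat m (Suc n)" using A1 by (rule append_col_carrier)
  have "append_col A1 b1 *\<^sub>v z = 0\<^sub>v m"
    unfolding z_def append_col_mult_tls_vec[OF A1 b1 x] A1x using b1 by simp
  then have Ez: "(C - append_col A1 b1) *\<^sub>v z = C *\<^sub>v z"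
    unfolding minus_mult_distrib_mat_vec[OF C C1 z] using C z by auto
  have "(C *\<^sub>v z) \<bullet> (C *\<^sub>v z) \<le> (frobenius_norm (C - append_col A1 b1))\<^sup>2 * (z \<bullet> z)"
    unfolding Ez[symmetric] by (rule norm_sq_mult_le_frobenius[OF minus_carrier_mat[OF C1] z])
  also have "\<dots> \<le> (\<sigma> n)\<^sup>2 * (z \<bullet> z)"
    using E_le by (intro mult_right_mono) (auto simp: scalar_prod_def intro: sum_nonneg)
  finally obtain c where c: "z = c \<cdot>\<^sub>v col V n"
    by (rule small_image_imp_parallel[OF z])
  have comp: "z $ i = c * V $$ (i, n)" if "i < Suc n" for i
    unfolding c using that V by simp
  have "z $ n = - 1" using x by (simp add: z_def tls_vec_def)
  then have "c = - 1 / V $$ (n, n)"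
    using comp[of n] last_component_nonzero by (simp add: field_simps)
  moreover have "x $ i = z $ i" if "i < n" for i
    using that x by (simp add: z_def tls_vec_def)
  ultimately show "\<And>i. i < n \<Longrightarrow> x $ i = - V $$ (i, n) / V $$ (n, n)"
    using comp by simp
  show "x \<in> carrier_vec n" by (fact x)
qed

lemma tls_sol_eq:
  assumes sol: "tls_solution A b x"
  shows "tls_sol A b = x"
  unfolding tls_sol_def
proof (rule the_equality)
  fix y assume y: "tls_solution A b y"
  show "y = x"
    using tls_solution_components[OF y] tls_solution_components[OF sol] by (intro eq_vecI) auto
qed (fact sol)

section \<open>The inverse of P in terms of the decomposition\<close>

text \<open>
  For \<open>i < n\<close>, orthogonality of columns \<open>i\<close> and \<open>n\<close> of \<open>V\<close> gives \<open>(W\<^sup>T x)\<^sub>i = V\<^sub>n\<^sub>i\<close>. So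
  \<open>W\<^sup>T W + (W\<^sup>T x) (W\<^sup>T x)\<^sup>T\<close> completes the inner products of truncated columns by the
  products of the entries in the last row, that is, to those of full columns.
\<close>

lemma leading_block_congruence:
  assumes sol: "tls_solution A b x"
    and W_def: "W = mat n n (\<lambda>(i, j). V $$ (i, j))"
    and S_def: "S = 1\<^sub>m n + col_matrix x * row_matrix x"
  shows "transpose_mat W * S * W = 1\<^sub>m n"
proof (rule eq_matI)
  have x_index: "x $ i = - V $$ (i, n) / V $$ (n, n)" if "i < n" for i
    using tls_solution_components(2)[OF sol that] .
  have x: "x \<in> carrier_vec n" using tls_solution_components[OF sol] by simp
  have W: "W \<in> carrier_mat n n" by (simp add: W_def)
  have xx: "col_matrix x * row_matrix x \<in> carrier_mat n n"
    using x unfolding col_matrix_def row_matrix_def by (intro carrier_matI) simp_all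
  have S: "S \<in> carrier_mat n n" unfolding S_def using xx by simp
  have S_index: "S $$ (k, l) = (if k = l then 1 else 0) + x $ k * x $ l" if "k < n" "l < n" for k l
    using that x xx by (simp add: S_def col_matrix_def row_matrix_def scalar_prod_def
        mat_of_cols_index mat_of_rows_index)
  have ortho: "(\<Sum>l<n. V $$ (l, i) * V $$ (l, j)) = (if i = j then 1 else 0) - V $$ (n, i) * V $$ (n, j)"
    if "i < Suc n" "j < Suc n" for i j
    using svd_cols_orthonormal[OF svd C that] by simp
  have Wx: "(\<Sum>k<n. V $$ (k, i) * x $ k) = V $$ (n, i)" if "i < n" for i
  proof -
    have "(\<Sum>k<n. V $$ (k, i) * x $ k) = - (\<Sum>k<n. V $$ (k, i) * V $$ (k, n)) / V $$ (n, n)"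
      by (simp add: x_index sum_negf sum_divide_distrib)
    also have "\<dots> = V $$ (n, i)"
      using ortho[of i n] that last_component_nonzero by simp
    finally show ?thesis .
  qed
  fix i j assume "i < dim_row (1\<^sub>m n :: real mat)" "j < dim_col (1\<^sub>m n :: real mat)"
  then have ij: "i < n" "j < n" by auto
  have SW: "(S * W) $$ (k, j) = V $$ (k, j) + x $ k * V $$ (n, j)" if k: "k < n" for k
  proof -
    have "(S * W) $$ (k, j) = (\<Sum>l<n. S $$ (k, l) * V $$ (l, j))"
      using k ij S by (simp add: scalar_prod_def lessThan_atLeast0 W_def)
    also have "\<dots> = (\<Sum>l<n. (if l = k then V $$ (k, j) else 0) + x $ k * (V $$ (l, j) * x $ l))"
      using k by (intro sum.cong) (auto simp: S_index algebra_simps)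
    also have "\<dots> = V $$ (k, j) + x $ k * V $$ (n, j)"
      using k by (simp add: sum.distrib Wx[OF ij(2)] flip: sum_distrib_left)
    finally show ?thesis .
  qed
  have "(transpose_mat W * S * W) $$ (i, j) = (transpose_mat W * (S * W)) $$ (i, j)"
    using W S by (simp only: assoc_mult_mat[OF transpose_carrier_mat[THEN iffD2, OF W] S W])
  also have "\<dots> = (\<Sum>k<n. V $$ (k, i) * (S * W) $$ (k, j))"
    using ij S by (simp add: scalar_prod_def lessThan_atLeast0 W_def)
  also have "\<dots> = (\<Sum>k<n. V $$ (k, i) * V $$ (k, j)) + (\<Sum>k<n. V $$ (k, i) * x $ k) * V $$ (n, j)"
    by (simp add: SW algebra_simps sum.distrib sum_distrib_left)
  also have "\<dots> = (1\<^sub>m n) $$ (i, j)"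
    using ij ortho[of i j] by (simp add: Wx)
  finally show "(transpose_mat W * S * W) $$ (i, j) = (1\<^sub>m n) $$ (i, j)" .
qed (auto simp: W_def)

text \<open>
  The entries of \<open>C\<^sup>T C - (\<sigma> n)\<^sup>2 V V\<^sup>T\<close> are sums over all \<open>n + 1\<close> singular vectors, in which the last
  term has coefficient 0.
\<close>

lemma tls_P_factorization:
  assumes W_def: "W = mat n n (\<lambda>(i, j). V $$ (i, j))"
    and D_def: "D = mat_diag n (\<lambda>i. (\<sigma> i)\<^sup>2 - (\<sigma> n)\<^sup>2)"
  shows "tls_P A b = W * D * transpose_mat W"
proof (rule eq_matI)
  have W: "W \<in> carrier_mat n n" by (simp add: W_def)
  fix i j assume "i < dim_row (W * D * transpose_mat W)" "j < dim_col (W * D * transpose_mat W)"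
  then have ij: "i < n" "j < n" by (auto simp: W_def)
  have "tls_P A b $$ (i, j) = (transpose_mat C * C) $$ (i, j) - (\<sigma> n)\<^sup>2 * (if i = j then 1 else 0)"
    using ij A
    by (simp add: tls_P_def smallest_singular_value_C gram_append_col_index[OF A b] del: index_mult_mat(1))
  also have "\<dots> = (\<Sum>l<Suc n. ((\<sigma> l)\<^sup>2 - (\<sigma> n)\<^sup>2) * (V $$ (i, l) * V $$ (j, l)))"
    using ij gram_svd_index[OF svd C cols_le_rows, of i j] svd_rows_orthonormal[OF svd C, of i j, symmetric]
    by (simp add: left_diff_distrib sum_subtractf del: sum.lessThan_Suc index_mult_mat(1) flip: sum_distrib_left)
  also have "\<dots> = (W * D * transpose_mat W) $$ (i, j)"
    unfolding D_def mat_diag_mult_right[OF W]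
    using ij by (simp add: scalar_prod_def lessThan_atLeast0 W_def algebra_simps)
  finally show "tls_P A b $$ (i, j) = (W * D * transpose_mat W) $$ (i, j)" .
qed (use A in \<open>auto simp: tls_P_def W_def\<close>)

lemma minv_diagonal_gaps:
  "minv (mat_diag n (\<lambda>i. (\<sigma> i)\<^sup>2 - (\<sigma> n)\<^sup>2)) = mat_diag n (\<lambda>i. 1 / ((\<sigma> i)\<^sup>2 - (\<sigma> n)\<^sup>2))"
  and diagonal_gaps_inverse:
  "mat_diag n (\<lambda>i. (\<sigma> i)\<^sup>2 - (\<sigma> n)\<^sup>2) * mat_diag n (\<lambda>i. 1 / ((\<sigma> i)\<^sup>2 - (\<sigma> n)\<^sup>2)) = 1\<^sub>m n"
proof -
  have "(\<sigma> i)\<^sup>2 - (\<sigma> n)\<^sup>2 \<noteq> 0" if "i < n" for i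
    using power_strict_mono[OF last_sigma_less[OF that] last_sigma_nonneg, of 2] by simp
  then show inv: "mat_diag n (\<lambda>i. (\<sigma> i)\<^sup>2 - (\<sigma> n)\<^sup>2) * mat_diag n (\<lambda>i. 1 / ((\<sigma> i)\<^sup>2 - (\<sigma> n)\<^sup>2)) = 1\<^sub>m n"
    unfolding mat_diag_diag by (intro eq_matI) (auto simp: mat_diag_def)
  show "minv (mat_diag n (\<lambda>i. (\<sigma> i)\<^sup>2 - (\<sigma> n)\<^sup>2)) = mat_diag n (\<lambda>i. 1 / ((\<sigma> i)\<^sup>2 - (\<sigma> n)\<^sup>2))"
    by (rule minv_eqI[OF _ _ inv]) simp_all
qed

lemma minv_tls_P:
  assumes sol: "tls_solution A b x"
    and W_def: "W = mat n n (\<lambda>(i, j). V $$ (i, j))"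
    and D_def: "D = mat_diag n (\<lambda>i. (\<sigma> i)\<^sup>2 - (\<sigma> n)\<^sup>2)"
    and S_def: "S = 1\<^sub>m n + col_matrix x * row_matrix x"
  shows "minv (tls_P A b) = S * (W * minv D * transpose_mat W) * S"
proof (rule minv_eqI)
  have x: "x \<in> carrier_vec n" using tls_solution_components[OF sol] by simp
  have W: "W \<in> carrier_mat n n" by (simp add: W_def)
  have "col_matrix x * row_matrix x \<in> carrier_mat n n"
    using x unfolding col_matrix_def row_matrix_def by (intro carrier_matI) simp_all
  then have S: "S \<in> carrier_mat n n" unfolding S_def by simp
  have D: "D \<in> carrier_mat n n" and E: "minv D \<in> carrier_mat n n" and DE: "D * minv D = 1\<^sub>m n"
    by (simp_all only: D_def minv_diagonal_gaps diagonal_gaps_inverse mat_diag_dim)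
  show "tls_P A b \<in> carrier_mat n n"
    using A unfolding tls_P_def by (intro carrier_matI) simp_all
  show "S * (W * minv D * transpose_mat W) * S \<in> carrier_mat n n"
    using S W E by auto
  show "tls_P A b * (S * (W * minv D * transpose_mat W) * S) = 1\<^sub>m n"
    unfolding tls_P_factorization[OF W_def D_def]
    by (rule congruence_inverse[OF W D E _ S leading_block_congruence[OF sol W_def S_def] DE])
      (simp add: W)
qed

end

theorem corollary3p4:
  fixes m n k :: nat
    and A L U V V11 D Q Q1 G K :: "real mat"
    and b x r :: "real vec"
    and \<sigma> :: "nat \<Rightarrow> real"
  assumes "1 \<le> k" and "k \<le> n" and "n < m"
    and "A \<in> carrier_mat m n" and "b \<in> carrier_vec m" and "L \<in> carrier_mat k n"
    and "is_svd (append_col A b) U \<sigma> V"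
    and "tls_generic A b"
    and "tls_solution A b x"
    and "r = b - A *\<^sub>v x"
    and "V11 = mat n n (\<lambda>(i, j). V $$ (i, j))"
    and "D = mat_diag n (\<lambda>i. (\<sigma> i)\<^sup>2 - (\<sigma> n)\<^sup>2)"
    and "Q1 = 1\<^sub>m n + col_matrix x * row_matrix x"
    and "Q = V11 * minv D * transpose_mat V11"
    and "G = transpose_mat A + (2 / (1 + x \<bullet> x)) \<cdot>\<^sub>m (col_matrix x * row_matrix r)"
    and "K = (- row_matrix x) \<otimes>\<^sub>K G + 1\<^sub>m n \<otimes>\<^sub>K row_matrix r"
  shows "(L *\<^sub>v x \<noteq> 0\<^sub>v k \<longrightarrow>
            mixed_cond L A b =
              max_norm (abs_mat (L * Q1 * Q * Q1 * K) *\<^sub>v stack_cols (abs_mat A)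
                        + abs_mat (L * Q1 * Q * Q1 * G) *\<^sub>v abs_vec b)
              / max_norm (L *\<^sub>v x))
       \<and> componentwise_cond L A b =
              max_norm (moore_penrose (diag_of_vec (L *\<^sub>v x)) * abs_mat (L * Q1 * Q * Q1 * K)
                          *\<^sub>v stack_cols (abs_mat A)
                        + moore_penrose (diag_of_vec (L *\<^sub>v x)) * abs_mat (L * Q1 * Q * Q1 * G)
                          *\<^sub>v abs_vec b)"
proof -
  note A = assms(4) and b = assms(5) and L = assms(6) and sol = assms(9)
  interpret generic_tls m n A b U V \<sigma>
    by unfold_locales (fact assms)+
  have x: "x \<in> carrier_vec n" using tls_solution_components[OF sol] by simp
  have r: "r \<in> carrier_vec m" unfolding assms(10) using A b x by simp
  have x_sol: "tls_sol A b = x" by (rule tls_sol_eq[OF sol])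
  have inv: "minv (tls_P A b) = Q1 * Q * Q1"
    unfolding assms(14) by (rule minv_tls_P[OF sol assms(11-13)])
  have xr: "col_matrix x * row_matrix v \<in> carrier_mat n p" if "v \<in> carrier_vec p" for v p
    using x that unfolding col_matrix_def row_matrix_def by (intro carrier_matI) simp_all
  have Q1: "Q1 \<in> carrier_mat n n" unfolding assms(13) using xr[OF x] by simp
  have "minv D \<in> carrier_mat n n"
    unfolding assms(12) minv_diagonal_gaps by simp
  then have Q: "Q \<in> carrier_mat n n" unfolding assms(14) assms(11) by auto
  have G: "G \<in> carrier_mat n m" unfolding assms(15) using xr[OF r] A by simp
  have K: "K \<in> carrier_mat n (n * m)"
    unfolding assms(16) using G x r
    by (intro carrier_matI) (simp_all add: kronecker_def row_matrix_def)
  have N: "tls_N A b = Q1 * Q * Q1 * K"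
    unfolding tls_N_def Let_def x_sol assms(10)[symmetric] inv assms(15)[symmetric]
      carrier_matD[OF A] assms(16)[symmetric] ..
  have H: "tls_H A b = Q1 * Q * Q1 * G"
    unfolding tls_H_def Let_def x_sol assms(10)[symmetric] inv assms(15)[symmetric] ..
  have assoc: "L * (Q1 * Q * Q1 * B) = L * Q1 * Q * Q1 * B" if "B \<in> carrier_mat n p" for B p
    using L Q1 Q that
    by (simp add: assoc_mult_mat[of _ k n _ n _ n] assoc_mult_mat[of _ k n _ n _ p]
      assoc_mult_mat[of _ n n _ n _ n] assoc_mult_mat[of _ n n _ n _ p] mult_carrier_mat[of _ n n _ n]
      mult_carrier_mat[of _ n n _ p])
  have LN: "L * tls_N A b = L * Q1 * Q * Q1 * K" and LH: "L * tls_H A b = L * Q1 * Q * Q1 * G"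
    unfolding N H by (rule assoc[OF K], rule assoc[OF G])
  define M where "M = moore_penrose (diag_of_vec (L *\<^sub>v x))"
  have M: "M \<in> carrier_mat k k"
    unfolding M_def moore_penrose_diag_of_vec using L by simp
  define E where "E = abs_mat (L * Q1 * Q * Q1 * K)"
  define F where "F = abs_mat (L * Q1 * Q * Q1 * G)"
  have E: "E \<in> carrier_mat k (n * m)" and F: "F \<in> carrier_mat k m"
    unfolding E_def F_def using L K G by auto
  have s: "stack_cols (abs_mat A) \<in> carrier_vec (n * m)"
    using A by (intro carrier_vecI) (simp add: stack_cols_def mult.commute)
  have t: "abs_vec b \<in> carrier_vec m" using b by simp
  \<comment> \<open>Distributing over the sum needs the dimension of \<open>M\<close>, which the definite description in
    \<open>moore_penrose\<close> does not reveal; the explicit diagonal form does.\<close>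
  have split: "M *\<^sub>v (E *\<^sub>v stack_cols (abs_mat A) + F *\<^sub>v abs_vec b)
      = M * E *\<^sub>v stack_cols (abs_mat A) + M * F *\<^sub>v abs_vec b"
    unfolding assoc_mult_mat_vec[OF M E s] assoc_mult_mat_vec[OF M F t]
    by (rule mult_add_distrib_mat_vec[OF M mult_mat_vec_carrier[OF E s] mult_mat_vec_carrier[OF F t]])
  show ?thesis
    unfolding mixed_cond_def componentwise_cond_def tls_psi_def x_sol LN LH
      M_def[symmetric] E_def[symmetric] F_def[symmetric] split by simp
qed

end
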